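(* Let $n \ge 2$ and $k \ge 1$ be integers. For $i=1,\ldots,k$, let player $i$ hold a finite sequence (i.e., a multiset) $A_i$ whose support is a subset of $[n]=\{1,2,\ldots,n\}$ and with $|A_i|=O(\mathrm{poly}(n))$; not all $A_i$ are empty. Then there is a deterministic protocol for finding the median of the multiset sum $\biguplus_{i=1}^k A_i$ with communication complexity $O(k\log^2 n)$.
   Context: Multiparty communication model: each of the $k$ players knows only his/her own input $A_i$ (and the public parameters $n$, $k$). Players communicate by broadcasting bits: every message sent by one player is seen by all players (blackboard). A deterministic protocol specifies, as a function of the messages sent so far, who speaks next, and each message is a function of the speaker's own input and the messages so far. At the end of the protocol the required output is known to the players. The communication complexity of a protocol is the maximum, over all admissible inputs, of the total number of bits broadcast; local computation is free. Median: the median of a finite nonempty multiset $X$ is its $\lceil |X|/2\rceil$-th smallest element, counted with multiplicity. The multiset sum $\biguplus$ adds multiplicities, so $|\biguplus_i A_i|=\sum_i |A_i|$. The hypothesis $|A_i|=O(\mathrm{poly}(n))$ means that there is a fixed polynomial in $n$ (independent of $i$ and $k$) bounding all $|A_i|$. The number of players $k$ is independent of $n$; the constant implied in $O(k\log^2 n)$ depends only on that polynomial bound, not on $n$ or $k$. Logarithms are in base $2$. *)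

theory Defs
  imports
    Complex_Main
    "HOL-Library.Multiset"
    "HOL-Library.Extended_Real"
    "HOL-Computational_Algebra.Polynomial"
begin

text \<open>
  Deterministic blackboard protocols. The blackboard is the list of all bits broadcast so far,
  oldest first. It alone determines who broadcasts the next bit (or, if \<open>None\<close>, that the protocol
  has ended), and each bit depends only on the speaker's identity, the speaker's own input and the
  blackboard. A longer message is a run of consecutive bits by one speaker; working bit by bit
  ensures that neither empty messages nor message boundaries convey information free of charge.
  The output is read off the final blackboard, so it is known to every player.
\<close>

record ('a, 'b) protocol =
  speaker :: "bool list \<Rightarrow> nat option"
  next_bit :: "nat \<Rightarrow> 'a \<Rightarrow> bool list \<Rightarrow> bool"
  result :: "bool list \<Rightarrow> 'b"

definition protocol_for :: "nat \<Rightarrow> ('a, 'b) protocol \<Rightarrow> bool" where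
  "protocol_for k P \<longleftrightarrow> (\<forall>h i. speaker P h = Some i \<longrightarrow> i \<in> {1..k})"

inductive reaches :: "('a, 'b) protocol \<Rightarrow> (nat \<Rightarrow> 'a) \<Rightarrow> bool list \<Rightarrow> bool"
  for P :: "('a, 'b) protocol" and A :: "nat \<Rightarrow> 'a" where
  start: "reaches P A []"
| step: "reaches P A h \<Longrightarrow> speaker P h = Some i \<Longrightarrow> reaches P A (h @ [next_bit P i (A i) h])"

definition computes ::
  "('a, 'b) protocol \<Rightarrow> (nat \<Rightarrow> 'a) set \<Rightarrow> ((nat \<Rightarrow> 'a) \<Rightarrow> 'b) \<Rightarrow> bool" where
  "computes P S f \<longleftrightarrow>
     (\<forall>A\<in>S. \<exists>h. reaches P A h \<and> speaker P h = None \<and> result P h = f A)"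

text \<open>
  On a given input the reachable blackboards form a chain under the prefix order, so the supremum
  of their lengths is the number of bits broadcast (infinite if the protocol does not end).
\<close>

definition bits_broadcast :: "('a, 'b) protocol \<Rightarrow> (nat \<Rightarrow> 'a) \<Rightarrow> enat" where
  "bits_broadcast P A = (SUP h\<in>{h. reaches P A h}. enat (length h))"

definition comm_complexity :: "('a, 'b) protocol \<Rightarrow> (nat \<Rightarrow> 'a) set \<Rightarrow> enat" where
  "comm_complexity P S = (SUP A\<in>S. bits_broadcast P A)"

text \<open>The list index is shifted by one because \<open>(!)\<close> counts from zero.\<close>

definition median :: "'a::linorder multiset \<Rightarrow> 'a" where
  "median X = sorted_list_of_multiset X ! (nat \<lceil>real (size X) / 2\<rceil> - 1)"

text \<open>
  Only the values \<open>A 1, \<dots>, A k\<close> are the players' inputs; the values of \<open>A\<close> elsewhere are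
  irrelevant.
\<close>

definition admissible_inputs :: "real poly \<Rightarrow> nat \<Rightarrow> nat \<Rightarrow> (nat \<Rightarrow> nat multiset) set" where
  "admissible_inputs p n k =
     {A. (\<forall>i\<in>{1..k}. set_mset (A i) \<subseteq> {1..n} \<and> real (size (A i)) \<le> poly p (real n)) \<and>
         (\<exists>i\<in>{1..k}. A i \<noteq> {#})}"

end

theory Submission
  imports Defs
begin

text \<open>
  Binary search on the value of the median. Once the total size is known, each round broadcasts for
  every player the number of its elements below the current threshold, which takes \<open>O(log n)\<close> bits
  per player since these numbers are polynomially bounded; the sum of these numbers tells on which
  side of the threshold the median lies. The protocol is built backwards, as a decision tree: after
  each bit it only has to handle the inputs consistent with the bits seen so far.
\<close>

section \<open>Combining protocols\<close>

lemma reaches_nth: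
  assumes "reaches P A h" "j < length h"
  shows "\<exists>i. speaker P (take j h) = Some i \<and> h ! j = next_bit P i (A i) (take j h)"
  using assms
proof induction
  case start
  then show ?case by simp
next
  case (step h i)
  then show ?case
    by (cases "j < length h") (auto simp: nth_append less_Suc_eq)
qed

text \<open>Runs are deterministic: the board fixes the speaker and, with the input, the next bit,
  so two runs on one input cannot diverge, and nothing can be written past a final board.\<close>

lemma reaches_prefix_of_final:
  assumes "reaches P A h'" "reaches P A h" "speaker P h = None"
  shows "h' = take (length h') h"
  using assms(1)
proof induction
  case start
  then show ?case by simp
next
  case (step h' i)
  show ?case
  proof (cases "length h' < length h")
    case True
    then show ?thesis
      using reaches_nth[OF assms(2) True] step by (auto simp: take_Suc_conv_app_nth)
  next
    \<comment> \<open>Here the induction hypothesis forces \<open>h' = h\<close>, where nobody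
      speaks, so the step is impossible.\<close>
    case False
    then show ?thesis
      using step assms(3) by simp
  qed
qed

lemma bits_broadcast_le:
  assumes "reaches P A h" "speaker P h = None"
  shows "bits_broadcast P A \<le> enat (length h)"
  unfolding bits_broadcast_def
proof (rule SUP_least)
  fix h' assume "h' \<in> {h. reaches P A h}"
  then have "h' = take (length h') h"
    using reaches_prefix_of_final[OF _ assms] by simp
  then show "enat (length h') \<le> enat (length h)"
    by (metis enat_ord_simps(1) length_take min.cobounded1)
qed

text \<open>The cost is attached to a final board for each input instead of to the supremum
  \<open>comm_complexity\<close>. This makes termination, correctness and cost compose together when
  protocols are glued; \<open>solvableE\<close> translates back.\<close>

definition solvable ::
  "nat \<Rightarrow> (nat \<Rightarrow> 'a) set \<Rightarrow> ((nat \<Rightarrow> 'a) \<Rightarrow> 'b) \<Rightarrow> nat \<Rightarrow> bool" where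
  "solvable k S f c \<longleftrightarrow> (\<exists>P :: ('a, 'b) protocol. protocol_for k P \<and>
     (\<forall>A\<in>S. \<exists>h. reaches P A h \<and> speaker P h = None \<and> result P h = f A \<and> length h \<le> c))"

lemma solvableE:
  assumes "solvable k S f c"
  obtains P where "protocol_for k P" "computes P S f" "comm_complexity P S \<le> enat c"
proof -
  obtain P where P: "protocol_for k P"
    "\<forall>A\<in>S. \<exists>h. reaches P A h \<and> speaker P h = None \<and> result P h = f A \<and> length h \<le> c"
    using assms by (auto simp: solvable_def)
  have "comm_complexity P S \<le> enat c"
    unfolding comm_complexity_def
  proof (rule SUP_least)
    fix A assume "A \<in> S"
    with P(2) obtain h where "reaches P A h" "speaker P h = None" "length h \<le> c"
      by blast
    then show "bits_broadcast P A \<le> enat c"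
      using bits_broadcast_le order_trans enat_ord_simps(1) by metis
  qed
  moreover have "computes P S f"
    using P(2) by (auto simp: computes_def)
  ultimately show thesis
    using that P(1) by blast
qed

lemma solvable_mono:
  "solvable k S f c \<Longrightarrow> S' \<subseteq> S \<Longrightarrow> c \<le> c' \<Longrightarrow> solvable k S' f c'"
  unfolding solvable_def by (meson order_trans subset_iff)

lemma solvable_const:
  assumes "\<And>A. A \<in> S \<Longrightarrow> f A = y"
  shows "solvable k S f 0"
  unfolding solvable_def
  by (rule exI[of _ "\<lparr>speaker = \<lambda>_. None, next_bit = \<lambda>_ _ _. False, result = \<lambda>_. y\<rparr>"])
     (auto simp: protocol_for_def assms intro: exI[of _ "[]"] reaches.start)

text \<open>One node of the decision tree: player \<open>i\<close> announces \<open>g (A i)\<close>,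
  and a protocol chosen by that bit takes over on the rest of the board.\<close>

lemma solvable_bit:
  fixes g :: "'a \<Rightarrow> bool"
  assumes i: "i \<in> {1..k}" and sol: "\<And>b. solvable k {A \<in> S. g (A i) = b} f c"
  shows "solvable k S f (Suc c)"
proof -
  have "\<forall>b. \<exists>P. protocol_for k P \<and> (\<forall>A\<in>{A \<in> S. g (A i) = b}. \<exists>h. reaches P A h \<and>
      speaker P h = None \<and> result P h = f A \<and> length h \<le> c)"
    using sol by (simp add: solvable_def)
  then obtain Q where Q: "\<And>b. protocol_for k (Q b)"
    "\<And>A. A \<in> S \<Longrightarrow> \<exists>h. reaches (Q (g (A i))) A h \<and>
      speaker (Q (g (A i))) h = None \<and> result (Q (g (A i))) h = f A \<and> length h \<le> c"
    unfolding choice_iff by auto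
  \<comment> \<open>The continuation sees the board without its first bit. On the empty board player
    \<open>i\<close> still has to speak, so the unspecified \<open>hd []\<close> in
    \<open>result\<close> never affects an output.\<close>
  define P where "P = \<lparr>speaker = \<lambda>h. case h of [] \<Rightarrow> Some i | b # h' \<Rightarrow> speaker (Q b) h',
    next_bit = \<lambda>j a h. case h of [] \<Rightarrow> g a | b # h' \<Rightarrow> next_bit (Q b) j a h',
    result = \<lambda>h. result (Q (hd h)) (tl h)\<rparr>"
  have lift: "reaches P A (g (A i) # h)" if "reaches (Q (g (A i))) A h" for A h
    using that
  proof induction
    case start
    show ?case
      using reaches.step[OF reaches.start, of P i A] by (simp add: P_def)
  next
    case (step h j)
    then show ?case
      using reaches.step[OF step.IH, of j] by (simp add: P_def)
  qed
  have "protocol_for k P"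
    using Q(1) i by (auto simp: protocol_for_def P_def split: list.splits)
  moreover have "\<exists>h. reaches P A h \<and> speaker P h = None \<and> result P h = f A \<and> length h \<le> Suc c"
    if A: "A \<in> S" for A
  proof -
    obtain h where "reaches (Q (g (A i))) A h" "speaker (Q (g (A i))) h = None"
      "result (Q (g (A i))) h = f A" "length h \<le> c"
      using Q(2)[OF A] by blast
    then show ?thesis
      using lift by (intro exI[of _ "g (A i) # h"]) (auto simp: P_def)
  qed
  ultimately show ?thesis
    unfolding solvable_def by blast
qed

text \<open>Binary digits are sent from the least significant one: first the parity, then
  recursively the half. Hence \<open>g\<close> is generalised along with \<open>S\<close>.\<close>

lemma solvable_number:
  fixes g :: "'a \<Rightarrow> nat"
  assumes i: "i \<in> {1..k}"
  shows "(\<And>A. A \<in> S \<Longrightarrow> g (A i) < 2 ^ L) \<Longrightarrow> (\<And>v. solvable k {A \<in> S. g (A i) = v} f c) \<Longrightarrow>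
    solvable k S f (L + c)"
proof (induction L arbitrary: S g)
  case 0
  then have "{A \<in> S. g (A i) = 0} = S"
    by auto
  then show ?case
    using "0.prems"(2)[of 0] by simp
next
  case (Suc L)
  have "solvable k {A \<in> S. even (g (A i)) = b} f (L + c)" for b
  proof (rule Suc.IH[where g = "\<lambda>a. g a div 2"])
    fix A assume "A \<in> {A \<in> S. even (g (A i)) = b}"
    then have "g (A i) < 2 ^ Suc L"
      using Suc.prems(1) by simp
    then show "g (A i) div 2 < 2 ^ L"
      by simp
  next
    fix v
    \<comment> \<open>Parity and half together determine the number, so the continuation for that
      value applies.\<close>
    have "{A \<in> {A \<in> S. even (g (A i)) = b}. g (A i) div 2 = v}
        \<subseteq> {A \<in> S. g (A i) = (if b then 2 * v else 2 * v + 1)}"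
      by auto
    then show "solvable k {A \<in> {A \<in> S. even (g (A i)) = b}. g (A i) div 2 = v} f c"
      using solvable_mono[OF Suc.prems(2)] by blast
  qed
  then have "solvable k S f (Suc (L + c))"
    by (rule solvable_bit[OF i, where g = "\<lambda>a. even (g a)"])
  then show ?case
    by simp
qed

text \<open>Players announce their numbers one after another, from \<open>j\<close> down to 1, with
  \<open>L\<close> bits each. The continuation may depend on the sum alone, which is all that the
  median search uses.\<close>

lemma solvable_sum:
  fixes g :: "'a \<Rightarrow> nat"
  assumes "j \<le> k"
  shows "(\<And>A i. A \<in> S \<Longrightarrow> i \<in> {1..k} \<Longrightarrow> g (A i) < 2 ^ L) \<Longrightarrow>
    (\<And>v. solvable k {A \<in> S. (\<Sum>i=1..j. g (A i)) = v} f c) \<Longrightarrow> solvable k S f (j * L + c)"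
  using assms
proof (induction j arbitrary: S)
  case 0
  then show ?case
    using "0.prems"(2)[of 0] by simp
next
  case (Suc j)
  have player: "Suc j \<in> {1..k}"
    using Suc.prems(3) by simp
  have "solvable k S f (L + (j * L + c))"
  proof (rule solvable_number[OF player])
    show "g (A (Suc j)) < 2 ^ L" if "A \<in> S" for A
      using that Suc.prems(1) player by blast
    fix w
    show "solvable k {A \<in> S. g (A (Suc j)) = w} f (j * L + c)"
    proof (rule Suc.IH)
      fix v
      \<comment> \<open>With \<open>w\<close> already announced, a remaining sum \<open>v\<close>
        pins the total to \<open>v + w\<close>.\<close>
      have "{A \<in> {A \<in> S. g (A (Suc j)) = w}. (\<Sum>i=1..j. g (A i)) = v}
          \<subseteq> {A \<in> S. (\<Sum>i=1..Suc j. g (A i)) = v + w}"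
        by auto
      then show "solvable k {A \<in> {A \<in> S. g (A (Suc j)) = w}. (\<Sum>i=1..j. g (A i)) = v} f c"
        using solvable_mono[OF Suc.prems(2)] by blast
    qed (use Suc.prems in auto)
  qed
  then show ?case
    by (simp add: add.assoc)
qed

section \<open>Binary search for the median\<close>

lemma sorted_nth_le_iff:
  fixes xs :: "'a::linorder list"
  assumes "sorted xs" "i < length xs"
  shows "xs ! i \<le> m \<longleftrightarrow> i < length (filter (\<lambda>x. x \<le> m) xs)"
  using assms
proof (induction xs arbitrary: i)
  case (Cons x xs)
  show ?case
  proof (cases "x \<le> m")
    case True
    then show ?thesis
      using Cons by (cases i) auto
  next
    case False
    \<comment> \<open>In a sorted list, once the head exceeds \<open>m\<close> so do all later
      entries.\<close>
    then have "filter (\<lambda>x. x \<le> m) xs = []"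
      using Cons.prems(1) by (auto simp: filter_empty_conv)
    moreover have "x \<le> (x # xs) ! i"
      using Cons.prems by (cases i) auto
    ultimately show ?thesis
      using False by auto
  qed
qed simp

lemma median_index_less:
  assumes "X \<noteq> {#}"
  shows "nat \<lceil>real (size X) / 2\<rceil> - 1 < size X"
proof -
  have "size X > 0"
    using assms by (simp add: nonempty_has_size)
  moreover have "nat \<lceil>real (size X) / 2\<rceil> \<le> size X"
    by (simp add: nat_le_iff ceiling_le_iff)
  ultimately show ?thesis
    by linarith
qed

text \<open>Reduces comparing the median with a threshold to counting, and counts add up over the
  players. It works because the entries up to \<open>m\<close> form an initial segment of the sorted
  list; the \<open>- 1\<close> is the zero-based position.\<close>

lemma median_le_iff:
  fixes X :: "'a::linorder multiset"
  assumes "X \<noteq> {#}"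
  shows "median X \<le> m \<longleftrightarrow>
    nat \<lceil>real (size X) / 2\<rceil> - 1 < size (filter_mset (\<lambda>x. x \<le> m) X)"
proof -
  have "size (filter_mset (\<lambda>x. x \<le> m) X)
      = length (filter (\<lambda>x. x \<le> m) (sorted_list_of_multiset X))"
    by (metis mset_filter mset_sorted_list_of_multiset size_mset)
  moreover have "length (sorted_list_of_multiset X) = size X"
    by (metis mset_sorted_list_of_multiset size_mset)
  ultimately show ?thesis
    using sorted_nth_le_iff[of "sorted_list_of_multiset X"] median_index_less[OF assms]
    by (simp add: median_def)
qed

lemma median_in_set:
  assumes "X \<noteq> {#}"
  shows "median X \<in># X"
proof -
  have "length (sorted_list_of_multiset X) = size X"
    by (metis mset_sorted_list_of_multiset size_mset)
  then show ?thesis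
    using nth_mem[of _ "sorted_list_of_multiset X"] median_index_less[OF assms]
    by (simp add: median_def)
qed

text \<open>Common knowledge is carried by \<open>S\<close>: each announced sum shrinks it, and
  generalising over \<open>S\<close> and \<open>lo\<close> lets the induction continue on half of
  the interval. The known total \<open>N\<close> fixes the position of the median.\<close>

lemma solvable_median_between:
  fixes S :: "(nat \<Rightarrow> nat multiset) set"
  shows "(\<And>A i. A \<in> S \<Longrightarrow> i \<in> {1..k} \<Longrightarrow> size (A i) < 2 ^ L) \<Longrightarrow>
    (\<And>A. A \<in> S \<Longrightarrow> (\<Sum>i=1..k. size (A i)) = N) \<Longrightarrow>
    (\<And>A. A \<in> S \<Longrightarrow> (\<Sum>i=1..k. A i) \<noteq> {#}) \<Longrightarrow>
    (\<And>A. A \<in> S \<Longrightarrow> median (\<Sum>i=1..k. A i) \<in> {lo..<lo + 2 ^ r}) \<Longrightarrow>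
    solvable k S (\<lambda>A. median (\<Sum>i=1..k. A i)) (r * (k * L))"
proof (induction r arbitrary: S lo)
  case 0
  then have "median (\<Sum>i=1..k. A i) = lo" if "A \<in> S" for A
    using "0.prems"(4)[OF that] by simp
  then show ?case
    using solvable_const[of S _ lo] by simp
next
  case (Suc r)
  \<comment> \<open>The threshold is the last value of the lower half; the subtraction does not
    truncate because \<open>2 ^ r\<close> is positive.\<close>
  define m where "m = lo + 2 ^ r - 1"
  define g where "g = (\<lambda>a. size (filter_mset (\<lambda>x. x \<le> m) a))"
  let ?f = "\<lambda>A. median (\<Sum>i=1..k. A i)"
  have below: "?f A \<le> m \<longleftrightarrow> nat \<lceil>real N / 2\<rceil> - 1 < (\<Sum>i=1..k. g (A i))" if "A \<in> S" for A
  proof -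
    have "filter_mset (\<lambda>x. x \<le> m) (\<Sum>i\<in>I. A i) = (\<Sum>i\<in>I. filter_mset (\<lambda>x. x \<le> m) (A i))"
      if "finite I" for I
      using that by induction auto
    then show ?thesis
      using median_le_iff[OF Suc.prems(3)[OF that]] Suc.prems(2)[OF that]
      by (simp add: g_def del: of_nat_sum)
  qed
  have "solvable k S ?f (k * L + r * (k * L))"
  proof (rule solvable_sum[OF order_refl, where g = g])
    show "g (A i) < 2 ^ L" if "A \<in> S" "i \<in> {1..k}" for A i
      using Suc.prems(1)[OF that] size_filter_mset_lesseq[of "\<lambda>x. x \<le> m" "A i"]
      unfolding g_def by linarith
    fix v
    \<comment> \<open>The announced count \<open>v\<close> decides which half contains the
      median.\<close>
    define lo' where "lo' = (if nat \<lceil>real N / 2\<rceil> - 1 < v then lo else lo + 2 ^ r)"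
    show "solvable k {A \<in> S. (\<Sum>i=1..k. g (A i)) = v} ?f (r * (k * L))"
    proof (rule Suc.IH[where lo = lo'])
      fix A assume A: "A \<in> {A \<in> S. (\<Sum>i=1..k. g (A i)) = v}"
      then have "?f A \<le> m \<longleftrightarrow> nat \<lceil>real N / 2\<rceil> - 1 < v"
        using below by auto
      moreover have "?f A \<in> {lo..<lo + 2 ^ Suc r}"
        using A Suc.prems(4) by blast
      moreover have "(2::nat) ^ r > 0"
        by simp
      ultimately show "?f A \<in> {lo'..<lo' + 2 ^ r}"
        unfolding lo'_def m_def by auto
    qed (use Suc.prems in auto)
  qed
  then show ?case
    by simp
qed

lemma solvable_median:
  fixes S :: "(nat \<Rightarrow> nat multiset) set"
  assumes size: "\<And>A i. A \<in> S \<Longrightarrow> i \<in> {1..k} \<Longrightarrow> size (A i) < 2 ^ L"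
    and support: "\<And>A i. A \<in> S \<Longrightarrow> i \<in> {1..k} \<Longrightarrow> set_mset (A i) \<subseteq> {1..2 ^ r}"
    and nonempty: "\<And>A. A \<in> S \<Longrightarrow> \<exists>i\<in>{1..k}. A i \<noteq> {#}"
  shows "solvable k S (\<lambda>A. median (\<Sum>i=1..k. A i)) (Suc r * (k * L))"
proof -
  have total_nonempty: "(\<Sum>i=1..k. A i) \<noteq> {#}" if "A \<in> S" for A
    using nonempty[OF that] by (simp add: sum_eq_empty_iff)
  have total_median: "median (\<Sum>i=1..k. A i) \<in> {1..<1 + 2 ^ r}" if "A \<in> S" for A
  proof -
    have "\<exists>i\<in>{1..k}. median (\<Sum>i=1..k. A i) \<in># A i"
      using median_in_set[OF total_nonempty[OF that]] by (auto simp: set_mset_sum)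
    then show ?thesis
      using support[OF that] by fastforce
  qed
  \<comment> \<open>A preliminary round announces the sizes to fix \<open>N\<close>; this accounts
    for the extra \<open>k * L\<close>.\<close>
  have "solvable k S (\<lambda>A. median (\<Sum>i=1..k. A i)) (k * L + r * (k * L))"
  proof (rule solvable_sum[OF order_refl, where g = size])
    fix N
    show "solvable k {A \<in> S. (\<Sum>i=1..k. size (A i)) = N} (\<lambda>A. median (\<Sum>i=1..k. A i))
      (r * (k * L))"
      by (rule solvable_median_between[where lo = 1 and N = N])
         (use size total_nonempty total_median in auto)
  qed (use size in auto)
  then show ?thesis
    by simp
qed

section \<open>Polynomial size bounds and the final constant\<close>

lemma poly_less_power:
  fixes p :: "real poly"
  shows "\<exists>D. \<forall>x\<ge>2. poly p x < x ^ D"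
proof (induction p)
  case 0
  show ?case
    by (intro exI[of _ 0]) simp
next
  case (pCons a p)
  then obtain D where D: "\<And>x. x \<ge> 2 \<Longrightarrow> poly p x < x ^ D"
    by blast
  obtain E where E: "a < 2 ^ E"
    using real_arch_pow[of 2 a] by auto
  \<comment> \<open>Both \<open>a\<close> and \<open>x * poly p x\<close> are bounded by
    \<open>x ^ (D + E + 1)\<close>, and the factor 2 from adding them is absorbed by one more
    \<open>x\<close>.\<close>
  have "poly (pCons a p) x < x ^ (D + E + 2)" if x: "x \<ge> 2" for x
  proof -
    have "a < x ^ E"
      using E power_mono[OF x, of E] by simp
    also have "x ^ E \<le> x ^ (D + E + 1)"
      using x by (intro power_increasing) auto
    finally have 1: "a < x ^ (D + E + 1)" .
    have "x * poly p x \<le> x * x ^ D"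
      using D[OF x] x by (intro mult_left_mono) auto
    also have "\<dots> = x ^ (D + 1)"
      by simp
    also have "\<dots> \<le> x ^ (D + E + 1)"
      using x by (intro power_increasing) auto
    finally have "poly (pCons a p) x < 2 * x ^ (D + E + 1)"
      using 1 by simp
    also have "\<dots> \<le> x * x ^ (D + E + 1)"
      using x by (intro mult_right_mono) auto
    finally show ?thesis
      by simp
  qed
  then show ?case
    by blast
qed

theorem theorem1:
  fixes p :: "real poly"
  shows "\<exists>C::real. \<forall>n\<ge>2. \<forall>k\<ge>1. \<exists>P :: (nat multiset, nat) protocol.
           protocol_for k P \<and>
           computes P (admissible_inputs p n k) (\<lambda>A. median (\<Sum>i=1..k. A i)) \<and>
           ereal_of_enat (comm_complexity P (admissible_inputs p n k))
             \<le> ereal (C * real k * (log 2 (real n))\<^sup>2)"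
proof -
  \<comment> \<open>\<open>D\<close> depends only on \<open>p\<close>, so the constant
    \<open>6 * real D\<close> is uniform in \<open>n\<close> and \<open>k\<close>.\<close>
  obtain D where D: "\<And>x. x \<ge> 2 \<Longrightarrow> poly p x < x ^ D"
    using poly_less_power by blast
  have "\<exists>P :: (nat multiset, nat) protocol. protocol_for k P \<and>
           computes P (admissible_inputs p n k) (\<lambda>A. median (\<Sum>i=1..k. A i)) \<and>
           ereal_of_enat (comm_complexity P (admissible_inputs p n k))
             \<le> ereal (6 * real D * real k * (log 2 (real n))\<^sup>2)"
    if n: "n \<ge> 2" and k: "k \<ge> 1" for n k :: nat
  proof -
    define l where "l = log 2 (real n)"
    \<comment> \<open>Since \<open>n \<le> 2 ^ T\<close>, \<open>T\<close> halvings isolate the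
      median and \<open>T * D\<close> bits hold any count below \<open>n ^ D\<close>.\<close>
    define T where "T = nat \<lceil>l\<rceil>"
    have l: "l \<ge> 1"
      using n by (simp add: l_def)
    have T: "l \<le> real T" "real T \<le> l + 1"
      using l unfolding T_def by linarith+
    have "real n = 2 powr l"
      using n by (simp add: l_def)
    also have "\<dots> \<le> 2 powr real T"
      using T by (intro powr_mono) auto
    also have "\<dots> = 2 ^ T"
      by (simp add: powr_realpow)
    finally have nT: "real n \<le> 2 ^ T" .
    have "solvable k (admissible_inputs p n k) (\<lambda>A. median (\<Sum>i=1..k. A i)) (Suc T * (k * (T * D)))"
    proof (rule solvable_median)
      fix A i assume A: "A \<in> admissible_inputs p n k" "i \<in> {1..k}"
      have "real (size (A i)) \<le> poly p (real n)"
        using A unfolding admissible_inputs_def by blast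
      also have "\<dots> < real n ^ D"
        using D n by simp
      also have "\<dots> \<le> (2 ^ T) ^ D"
        using nT by (intro power_mono) auto
      also have "\<dots> = real (2 ^ (T * D))"
        by (simp add: power_mult)
      finally show "size (A i) < 2 ^ (T * D)"
        by (simp only: of_nat_less_iff)
      have "real n \<le> real (2 ^ T)"
        using nT by simp
      then have "n \<le> 2 ^ T"
        by (simp only: of_nat_le_iff)
      moreover have "set_mset (A i) \<subseteq> {1..n}"
        using A unfolding admissible_inputs_def by blast
      ultimately show "set_mset (A i) \<subseteq> {1..2 ^ T}"
        by fastforce
    qed (auto simp: admissible_inputs_def)
    then obtain P where P: "protocol_for k P"
      "computes P (admissible_inputs p n k) (\<lambda>A. median (\<Sum>i=1..k. A i))"
      "comm_complexity P (admissible_inputs p n k) \<le> enat (Suc T * (k * (T * D)))"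
      by (rule solvableE)
    \<comment> \<open>From \<open>T \<le> l + 1\<close> and \<open>l \<ge> 1\<close> follow
      \<open>T \<le> 2 * l\<close> and \<open>T + 1 \<le> 3 * l\<close>, whence the factor
      6.\<close>
    have "(real T + 1) * real T \<le> (3 * l) * (2 * l)"
      using T l by (intro mult_mono) auto
    then have "real D * real k * ((real T + 1) * real T) \<le> real D * real k * ((3 * l) * (2 * l))"
      by (intro mult_left_mono) auto
    then have "real (Suc T * (k * (T * D))) \<le> 6 * real D * real k * l\<^sup>2"
      by (simp add: power2_eq_square algebra_simps)
    moreover have "ereal_of_enat (comm_complexity P (admissible_inputs p n k))
        \<le> ereal (real (Suc T * (k * (T * D))))"
      using P(3) by (metis ereal_of_enat_le_iff ereal_of_enat_simps(1))
    ultimately have "ereal_of_enat (comm_complexity P (admissible_inputs p n k))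
        \<le> ereal (6 * real D * real k * l\<^sup>2)"
      by (meson ereal_less_eq(3) order_trans)
    then show ?thesis
      using P unfolding l_def by blast
  qed
  then show ?thesis
    by blast
qed

end
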